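(* Let $a,b$ be positive integers and $t\ge a+1$, $s\ge b+1$. Then \[ R^{a+b+1}\big(TK^{(a+1)}_t, TK^{(b+1)}_s\big)\le (t-a)(s-b)+a+b. \]
   Context: $K^{(m)}_n$ denotes the complete $m$-uniform hypergraph on $n$ vertices. For a hypergraph $\mathcal{H}'$ and a set $S\subseteq V(\mathcal{H}')$, the trace $\mathrm{Tr}(\mathcal{H}',S)$ is the hypergraph on $S$ with hyperedge set $\{h\cap S: h\in E(\mathcal{H}')\}$. For an $m$-uniform hypergraph $\mathcal{H}$ and $r\ge m$, $T\mathcal{H}$ is the set of $r$-uniform hypergraphs $\mathcal{H}'$ with $V(\mathcal{H})\subseteq V(\mathcal{H}')$ and $\mathrm{Tr}(\mathcal{H}',V(\mathcal{H}))=\mathcal{H}$. For collections $\mathcal{F}_1,\mathcal{F}_2$ of $r$-uniform hypergraphs, $R^r(\mathcal{F}_1,\mathcal{F}_2)$ is the least $N$ such that every 2-coloring of the hyperedges of the complete $r$-uniform hypergraph on $N$ vertices contains a subhypergraph of the first color isomorphic to a member of $\mathcal{F}_1$ or one of the second color isomorphic to a member of $\mathcal{F}_2$. Here $r=a+b+1$. *)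

theory Defs
  imports Main "HOL-Library.Extended_Nat"
begin

datatype 'a hypergraph = Hypergraph (verts: "'a set") (edges: "'a set set")

definition hypergraph :: "'a hypergraph \<Rightarrow> bool" where
  "hypergraph H \<longleftrightarrow> finite (verts H) \<and> (\<forall>e\<in>edges H. e \<subseteq> verts H)"

definition uniform :: "nat \<Rightarrow> 'a hypergraph \<Rightarrow> bool" where
  "uniform r H \<longleftrightarrow> hypergraph H \<and> (\<forall>e\<in>edges H. card e = r)"

definition complete_hypergraph :: "nat \<Rightarrow> nat \<Rightarrow> nat hypergraph" where
  "complete_hypergraph m n = Hypergraph {..<n} {e. e \<subseteq> {..<n} \<and> card e = m}"

definition hyper_trace :: "'a hypergraph \<Rightarrow> 'a set \<Rightarrow> 'a hypergraph" where
  "hyper_trace H S = Hypergraph S {h \<inter> S | h. h \<in> edges H}"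

definition trace_family :: "nat \<Rightarrow> 'a hypergraph \<Rightarrow> 'a hypergraph set" where
  "trace_family r H = {H'. uniform r H' \<and> verts H \<subseteq> verts H' \<and> hyper_trace H' (verts H) = H}"

definition subhypergraph :: "'a hypergraph \<Rightarrow> 'a hypergraph \<Rightarrow> bool" where
  "subhypergraph G H \<longleftrightarrow> hypergraph G \<and> verts G \<subseteq> verts H \<and> edges G \<subseteq> edges H"

definition hyper_iso :: "'a hypergraph \<Rightarrow> 'b hypergraph \<Rightarrow> bool" where
  "hyper_iso G H \<longleftrightarrow> (\<exists>f. bij_betw f (verts G) (verts H) \<and> (\<lambda>e. f ` e) ` edges G = edges H)"

definition contains_mono ::
  "'a hypergraph \<Rightarrow> ('a set \<Rightarrow> bool) \<Rightarrow> bool \<Rightarrow> 'b hypergraph set \<Rightarrow> bool" where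
  "contains_mono K c col F \<longleftrightarrow>
     (\<exists>G. subhypergraph G K \<and> (\<forall>e\<in>edges G. c e = col) \<and> (\<exists>H\<in>F. hyper_iso G H))"

definition ramsey_property ::
  "nat \<Rightarrow> 'a hypergraph set \<Rightarrow> 'a hypergraph set \<Rightarrow> nat \<Rightarrow> bool" where
  "ramsey_property r F1 F2 N \<longleftrightarrow>
     (\<forall>c. contains_mono (complete_hypergraph r N) c True F1
        \<or> contains_mono (complete_hypergraph r N) c False F2)"

text \<open>The infimum in \<^typ>\<open>enat\<close> is the least such \<open>N\<close> if one exists and \<open>\<infinity>\<close> otherwise, so a
  finite upper bound on the Ramsey number includes its existence.\<close>

definition ramsey_number ::
  "nat \<Rightarrow> 'a hypergraph set \<Rightarrow> 'a hypergraph set \<Rightarrow> enat" where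
  "ramsey_number r F1 F2 = Inf {enat N | N. ramsey_property r F1 F2 N}"

end

theory Submission
  imports Defs
begin

text \<open>Split the \<open>(t - a) (s - b) + a + b\<close> vertices into a set \<open>A\<^sub>0\<close> of size \<open>a\<close>, a set \<open>B\<^sub>0\<close> of size
  \<open>b\<close>, and \<open>t - a\<close> blocks of size \<open>s - b\<close>. If there is no member of the second family in the second
  color, then for every block \<open>P\<^sub>i\<close> the \<open>s\<close>-set \<open>S\<^sub>i = B\<^sub>0 \<union> P\<^sub>i\<close> has a \<open>(b + 1)\<close>-subset \<open>B\<^sub>i\<close> such that
  all edges meeting \<open>S\<^sub>i\<close> exactly in \<open>B\<^sub>i\<close> have the first color. As \<open>\<bar>B\<^sub>0\<bar> = b\<close>, there is
  \<open>v\<^sub>i \<in> B\<^sub>i \<inter> P\<^sub>i\<close>. The core of the required hypergraph is \<open>T = A\<^sub>0 \<union> {v\<^sub>i | i}\<close>: an \<open>(a + 1)\<close>-subset \<open>A\<close>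
  of \<open>T\<close> contains some \<open>v\<^sub>i\<close>, and \<open>A \<union> B\<^sub>i\<close> is an edge of the first color that meets \<open>T\<close> in \<open>A\<close>.\<close>

text \<open>The witness \<open>E\<close> takes every hyperedge of color \<open>col\<close> with
  exactly \<open>m\<close> vertices in \<open>S\<close>: this size condition keeps all other sets
  out of the trace, and \<open>ext\<close> puts every \<open>m\<close>-subset of \<open>S\<close>
  into it.\<close>

lemma contains_mono_trace_family:
  assumes S: "S \<subseteq> {..<N}" "card S = n"
    and ext: "\<And>A. A \<subseteq> S \<Longrightarrow> card A = m \<Longrightarrow>
      \<exists>h. h \<subseteq> {..<N} \<and> card h = r \<and> h \<inter> S = A \<and> c h = col"
  shows "contains_mono (complete_hypergraph r N) c col (trace_family r (complete_hypergraph m n))"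
proof -
  define E where "E = {h. h \<subseteq> {..<N} \<and> card h = r \<and> c h = col \<and> card (h \<inter> S) = m}"
  have finS: "finite S"
    using S(1) finite_subset by blast
  have nN: "n \<le> N"
    using S card_mono[of "{..<N}" S] by simp
  \<comment> \<open>Members of the trace family have \<open>{..<n}\<close> itself as core, so a
    permutation of \<open>{..<N}\<close> that carries \<open>S\<close> onto \<open>{..<n}\<close> is
    glued from two bijections.\<close>
  obtain f1 where f1: "bij_betw f1 S {..<n}"
    using S(2) finS by (metis bij_betw_iff_card card_lessThan finite_lessThan)
  have "card ({..<N} - S) = card {n..<N}"
    using S finS by (simp add: card_Diff_subset)
  then obtain f2 where f2: "bij_betw f2 ({..<N} - S) {n..<N}"
    by (metis bij_betw_iff_card finite_Diff finite_atLeastLessThan finite_lessThan)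
  define f where "f x = (if x \<in> S then f1 x else f2 x)" for x
  have fS: "bij_betw f S {..<n}"
    using f1 by (simp add: f_def cong: bij_betw_cong)
  have "bij_betw f ({..<N} - S) {n..<N}"
    using f2 by (subst bij_betw_cong[where g = f2]) (auto simp: f_def)
  with fS have "bij_betw f (S \<union> ({..<N} - S)) ({..<n} \<union> {n..<N})"
    by (rule bij_betw_combine) auto
  moreover have "S \<union> ({..<N} - S) = {..<N}" "{..<n} \<union> {n..<N} = {..<N}"
    using S(1) nN by auto
  ultimately have f: "bij_betw f {..<N} {..<N}"
    by simp
  have inj: "inj_on f {..<N}" and imS: "f ` S = {..<n}"
    using f fS by (auto simp: bij_betw_def)
  have im_Int: "f ` h \<inter> {..<n} = f ` (h \<inter> S)" if "h \<subseteq> {..<N}" for h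
    using inj_on_image_Int[OF inj that S(1)] imS by simp
  have card_im: "card (f ` h) = card h" if "h \<subseteq> {..<N}" for h
    using that inj card_image inj_on_subset by blast
  define H where "H = Hypergraph {..<N} ((`) f ` E)"
  have "uniform r H"
    using f by (auto simp: H_def E_def uniform_def hypergraph_def card_im bij_betw_def)
  moreover have "{h \<inter> {..<n} | h. h \<in> (`) f ` E} = {e. e \<subseteq> {..<n} \<and> card e = m}" (is "?L = ?R")
  proof
    show "?L \<subseteq> ?R"
    proof
      fix e assume "e \<in> ?L"
      then obtain h where h: "h \<in> E" "e = f ` h \<inter> {..<n}" by blast
      then have "e = f ` (h \<inter> S)" "h \<inter> S \<subseteq> {..<N}"
        using im_Int by (auto simp: E_def)
      then show "e \<in> ?R"
        using h card_im[of "h \<inter> S"] by (auto simp: E_def)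
    qed
    show "?R \<subseteq> ?L"
    proof
      fix e assume e: "e \<in> ?R"
      then obtain A where A: "A \<subseteq> S" "e = f ` A"
        by (metis (mono_tags, lifting) imS mem_Collect_eq subset_imageE)
      then have "card A = m"
        using e card_im[of A] S(1) by auto
      then obtain h where h: "h \<subseteq> {..<N}" "card h = r" "h \<inter> S = A" "c h = col"
        using ext A(1) by blast
      then have "h \<in> E" "f ` h \<inter> {..<n} = e"
        using \<open>card A = m\<close> A(2) im_Int by (auto simp: E_def)
      then show "e \<in> ?L" by blast
    qed
  qed
  ultimately have "H \<in> trace_family r (complete_hypergraph m n)"
    using nN by (auto simp: trace_family_def complete_hypergraph_def hyper_trace_def H_def)
  moreover have "hyper_iso (Hypergraph {..<N} E) H"
    using f by (auto simp: hyper_iso_def H_def)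
  moreover have "subhypergraph (Hypergraph {..<N} E) (complete_hypergraph r N)"
    by (auto simp: subhypergraph_def hypergraph_def complete_hypergraph_def E_def)
  moreover have "\<forall>e\<in>edges (Hypergraph {..<N} E). c e = col"
    by (simp add: E_def)
  ultimately show ?thesis
    unfolding contains_mono_def by blast
qed

text \<open>Here \<open>p\<close> and \<open>q\<close> stand for \<open>t - a\<close> and
  \<open>s - b\<close>, which avoids truncated subtraction.\<close>

lemma ramsey_property_trace_family:
  fixes a b p q :: nat
  shows "ramsey_property (a + b + 1)
           (trace_family (a + b + 1) (complete_hypergraph (a + 1) (p + a)))
           (trace_family (a + b + 1) (complete_hypergraph (b + 1) (q + b)))
           (p * q + a + b)"
  unfolding ramsey_property_def
proof (intro allI disjCI)
  fix c
  define N where "N = p * q + a + b"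
  assume "\<not> contains_mono (complete_hypergraph (a + b + 1) (p * q + a + b)) c False
            (trace_family (a + b + 1) (complete_hypergraph (b + 1) (q + b)))"
  then have not_blue: "\<not> contains_mono (complete_hypergraph (a + b + 1) N) c False
            (trace_family (a + b + 1) (complete_hypergraph (b + 1) (q + b)))"
    by (simp add: N_def)
  \<comment> \<open>Layout of the vertices: \<open>{..<a}\<close> is the set of size
    \<open>a\<close>, \<open>{a..<a + b}\<close> the set of size \<open>b\<close>, and the blocks
    \<open>P i\<close> of length \<open>q\<close> follow consecutively.\<close>
  define P where "P i = {a + b + i * q..<a + b + i * q + q}" for i
  define S where "S i = {a..<a + b} \<union> P i" for i
  have P_N: "P i \<subseteq> {..<N}" if "i < p" for i
  proof -
    have "(i + 1) * q \<le> p * q"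
      using that by (intro mult_le_mono1) simp
    then show ?thesis by (auto simp: P_def N_def)
  qed
  \<comment> \<open>A vertex determines its block, so the blocks are disjoint; this gives
    injectivity of \<open>v\<close> and \<open>T_S\<close>.\<close>
  have block_index: "(x - (a + b)) div q = i" if "x \<in> P i" for x i
  proof -
    define j where "j = x - (a + b + i * q)"
    have "x - (a + b) = i * q + j" "j < q"
      using that by (auto simp: P_def j_def)
    then show ?thesis by simp
  qed
  have "\<exists>B. B \<subseteq> S i \<and> card B = b + 1 \<and>
      (\<forall>h. h \<subseteq> {..<N} \<and> card h = a + b + 1 \<and> h \<inter> S i = B \<longrightarrow> c h)" if "i < p" for i
  \<comment> \<open>Otherwise every \<open>(b + 1)\<close>-subset of \<open>S i\<close> is the trace
    of a hyperedge of color \<open>False\<close>, and \<open>S i\<close> is the core of a member of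
    the second family.\<close>
  proof (rule ccontr)
    assume none: "\<not> ?thesis"
    have "card (S i) = q + b"
      unfolding S_def by (subst card_Un_disjoint) (auto simp: P_def)
    moreover have "S i \<subseteq> {..<N}"
      using P_N[OF that] by (auto simp: S_def N_def)
    ultimately have "contains_mono (complete_hypergraph (a + b + 1) N) c False
            (trace_family (a + b + 1) (complete_hypergraph (b + 1) (q + b)))"
      using none by (intro contains_mono_trace_family[of "S i"]) auto
    with not_blue show False by blast
  qed
  then obtain B where B: "\<And>i. i < p \<Longrightarrow> B i \<subseteq> S i" "\<And>i. i < p \<Longrightarrow> card (B i) = b + 1"
    and red: "\<And>i h. i < p \<Longrightarrow> h \<subseteq> {..<N} \<Longrightarrow> card h = a + b + 1 \<Longrightarrow> h \<inter> S i = B i \<Longrightarrow> c h"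
    by metis
  have "\<exists>v. v \<in> B i \<inter> P i" if "i < p" for i
  proof (rule ccontr)
    assume "\<not> ?thesis"
    then have "B i \<subseteq> {a..<a + b}"
      using B(1)[OF that] by (auto simp: S_def)
    then show False
      using B(2)[OF that] card_mono[of "{a..<a + b}" "B i"] by simp
  qed
  then obtain v where v: "\<And>i. i < p \<Longrightarrow> v i \<in> B i" "\<And>i. i < p \<Longrightarrow> v i \<in> P i"
    by (metis Int_iff)
  define T where "T = {..<a} \<union> v ` {..<p}"
  have v_ge: "a + b \<le> v i" if "i < p" for i
    using v(2)[OF that] by (auto simp: P_def)
  have "inj_on v {..<p}"
    by (rule inj_on_inverseI[where g = "\<lambda>x. (x - (a + b)) div q"]) (use v(2) block_index in auto)
  moreover have "{..<a} \<inter> v ` {..<p} = {}"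
    using v_ge by fastforce
  ultimately have card_T: "card T = p + a"
    by (simp add: T_def card_Un_disjoint card_image)
  have T_N: "T \<subseteq> {..<N}"
    using v(2) P_N by (auto simp: T_def N_def)
  \<comment> \<open>\<open>S i\<close> avoids \<open>{..<a}\<close>, and each \<open>v j\<close>
    with \<open>j \<noteq> i\<close> lies in another block.\<close>
  have T_S: "x = v i" if x: "x \<in> T" "x \<in> S i" and "i < p" for x i
  proof -
    obtain j where j: "j < p" "x = v j"
      using x by (auto simp: T_def S_def P_def)
    then have "x \<in> P i"
      using x(2) v_ge[OF j(1)] by (auto simp: S_def)
    then have "j = i"
      using block_index[of x i] block_index[of x j] v(2)[OF j(1)] j(2) by simp
    then show ?thesis using j by simp
  qed
  have "contains_mono (complete_hypergraph (a + b + 1) N) c True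
          (trace_family (a + b + 1) (complete_hypergraph (a + 1) (p + a)))"
  proof (rule contains_mono_trace_family[OF T_N card_T])
    fix A assume A: "A \<subseteq> T" "card A = a + 1"
    then have finA: "finite A" by (simp add: card_ge_0_finite)
    have "\<not> A \<subseteq> {..<a}"
      using A(2) card_mono[of "{..<a}" A] by auto
    then obtain i where i: "i < p" "v i \<in> A"
      using A(1) by (auto simp: T_def)
    have core: "x = v i" if "x \<in> T" "x \<in> S i" for x
      using T_S that i(1) by simp
    \<comment> \<open>The single common vertex makes the size of the union
      \<open>(a + 1) + (b + 1) - 1\<close>, exactly the uniformity.\<close>
    have AB: "A \<inter> B i = {v i}"
      using core A(1) B(1)[OF i(1)] v(1)[OF i(1)] i(2) by auto
    have finB: "finite (B i)"
      using B(2)[OF i(1)] by (simp add: card_ge_0_finite)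
    have "card (A \<union> B i) = a + b + 1"
      using card_Un_Int[OF finA finB] AB A(2) B(2)[OF i(1)] by simp
    moreover have "A \<union> B i \<subseteq> {..<N}"
      using A(1) T_N B(1)[OF i(1)] P_N[OF i(1)] by (auto simp: S_def N_def)
    moreover have "(A \<union> B i) \<inter> S i = B i"
      using core A(1) B(1)[OF i(1)] v(1)[OF i(1)] by auto
    moreover have "(A \<union> B i) \<inter> T = A"
      using core A(1) B(1)[OF i(1)] i(2) by auto
    ultimately show "\<exists>h. h \<subseteq> {..<N} \<and> card h = a + b + 1 \<and> h \<inter> T = A \<and> c h = True"
      using red[OF i(1)] by blast
  qed
  then show "contains_mono (complete_hypergraph (a + b + 1) (p * q + a + b)) c True
          (trace_family (a + b + 1) (complete_hypergraph (a + 1) (p + a)))"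
    by (simp add: N_def)
qed

theorem theorem4p2:
  fixes a b t s :: nat
  assumes "a \<ge> 1" and "b \<ge> 1" and "t \<ge> a + 1" and "s \<ge> b + 1"
  shows "ramsey_number (a + b + 1)
           (trace_family (a + b + 1) (complete_hypergraph (a + 1) t))
           (trace_family (a + b + 1) (complete_hypergraph (b + 1) s))
         \<le> enat ((t - a) * (s - b) + a + b)"
proof -
  have "t - a + a = t" "s - b + b = s"
    using assms by auto
  then show ?thesis
    using ramsey_property_trace_family[of a b "t - a" "s - b"]
    unfolding ramsey_number_def by (intro Inf_lower) auto
qed

end
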